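(* Let $K\ge1$, $\mathcal K=\{1,\dots,K\}$, let $\mathcal K'\subseteq\mathcal K$ be a fixed nonempty set with $|\mathcal K'|=K'$, and let $r\ge0$, $\rho>0$, $P_{\mathrm{IT}}>0$, $P_{\mathrm{LO}}>0$, $P_{\mathrm{RF}}>0$ and $\sigma_k^2>0$, $\chi_k>0$ ($k\in\mathcal K$) be constants independent of $N$. For each $N\ge1$ let $\mathbf h_k=\mathbf h_k^{(N)}\in\mathbb C^N$ ($k\in\mathcal K$) be random channels such that $\frac1N\|\mathbf h_k\|_2^2\to\chi_k$ almost surely as $N\to\infty$, and put $\omega_k=\|\mathbf h_k\|_2^2/\sigma_k^2$. Define $$P_{\mathrm{cir}}^{\mathrm{SLM}}=P_{\mathrm{LO}}+KP_{\mathrm{RF}}+\frac{(K+N)(K+N+1)}2P_{\mathrm{IT}},$$ $$A_{\mathcal K'}=P_{\mathrm{cir}}^{\mathrm{SLM}}+\frac1\rho\sum_{k\notin\mathcal K'}\frac{2^r-1}{\omega_k}-\frac1\rho\sum_{k\in\mathcal K'}\frac1{\omega_k},\qquad B_{\mathcal K'}=(K-K')r+\sum_{k\in\mathcal K'}\log_2(\omega_k)+K'\log_2\!\Big(\frac\rho{\ln2}\Big),$$ $$\eta^{\mathrm{SLM}}=\frac{K'}{A_{\mathcal K'}\ln2}\,W\!\left(\frac{A_{\mathcal K'}\ln2}{K'}\exp\!\Big(\frac{B_{\mathcal K'}\ln2}{K'}-1\Big)\right),$$ where $W$ is the principal branch of the Lambert function. Then $\eta^{\mathrm{SLM}}$ scales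 as $\ln(N)/N^2$ with asymptotic scaling factor $\frac{6K'}{P_{\mathrm{IT}}\ln2}$; that is, almost surely, $$\lim_{N\to\infty}\frac{N^2}{\ln N}\,\eta^{\mathrm{SLM}}=\frac{6K'}{P_{\mathrm{IT}}\ln 2}.$$
   Context: $\eta^{\mathrm{SLM}}$ is the optimal energy efficiency of the single-layer microwave linear analog computer (SLM) architecture with $N$ transmit antennas and $K$ users, under orthogonal user channels and no quantization noise, expressed through the set $\mathcal K'$ of users whose rate strictly exceeds the minimum rate $r$. $P_{\mathrm{LO}}$ is the local oscillator power, $P_{\mathrm{RF}}$ the power of one RF chain (sum of its component powers), $P_{\mathrm{IT}}$ the power of one impedance tuning element, $\rho$ the power amplifier efficiency. For all sufficiently large $N$ one has $\omega_k>0$ and $A_{\mathcal K'}>0$ almost surely, so $\eta^{\mathrm{SLM}}$ is well defined. *)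

theory Defs
  imports "HOL-Probability.Probability"
begin

text \<open>Principal real branch of the Lambert function: for \<open>x \<ge> - 1 / e\<close> it is the unique
  \<open>w \<ge> - 1\<close> with \<open>w * exp w = x\<close>; outside that domain the value is unspecified.\<close>

definition lambert_W :: "real \<Rightarrow> real" where
  "lambert_W x = (THE w. w \<ge> - 1 \<and> w * exp w = x)"

text \<open>A vector of \<open>\<complex>\<^sup>N\<close> is a function on the index set \<open>{..<N}\<close>; a random vector is a measurable
  map into the product space \<open>PiM {..<N} (\<lambda>_. borel)\<close>.\<close>

definition vec_norm :: "nat \<Rightarrow> (nat \<Rightarrow> complex) \<Rightarrow> real" where
  "vec_norm N v = L2_set (\<lambda>i. cmod (v i)) {..<N}"

definition omega :: "nat \<Rightarrow> (nat \<Rightarrow> real) \<Rightarrow> (nat \<Rightarrow> nat \<Rightarrow> complex) \<Rightarrow> nat \<Rightarrow> real" where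
  "omega N \<sigma> h k = (vec_norm N (h k))\<^sup>2 / (\<sigma> k)\<^sup>2"

definition P_cir_SLM :: "real \<Rightarrow> real \<Rightarrow> real \<Rightarrow> nat \<Rightarrow> nat \<Rightarrow> real" where
  "P_cir_SLM P_LO P_RF P_IT K N =
     P_LO + real K * P_RF + (real K + real N) * (real K + real N + 1) / 2 * P_IT"

text \<open>Below, \<open>S\<close> is the set of users whose rate exceeds the minimum rate \<open>r\<close>, \<open>P\<close> is the circuit
  power and \<open>w k\<close> stands for \<open>\<omega>\<^sub>k\<close>; the users are \<open>{1..K}\<close>.\<close>

definition A_coeff :: "nat \<Rightarrow> nat set \<Rightarrow> real \<Rightarrow> real \<Rightarrow> real \<Rightarrow> (nat \<Rightarrow> real) \<Rightarrow> real" where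
  "A_coeff K S r \<rho> P w =
     P + 1 / \<rho> * (\<Sum>k\<in>{1..K} - S. (2 powr r - 1) / w k) - 1 / \<rho> * (\<Sum>k\<in>S. 1 / w k)"

definition B_coeff :: "nat \<Rightarrow> nat set \<Rightarrow> real \<Rightarrow> real \<Rightarrow> (nat \<Rightarrow> real) \<Rightarrow> real" where
  "B_coeff K S r \<rho> w =
     (real K - real (card S)) * r + (\<Sum>k\<in>S. log 2 (w k)) + real (card S) * log 2 (\<rho> / ln 2)"

definition eta_SLM ::
  "real \<Rightarrow> real \<Rightarrow> real \<Rightarrow> nat \<Rightarrow> nat set \<Rightarrow> real \<Rightarrow> real \<Rightarrow> nat \<Rightarrow> (nat \<Rightarrow> real) \<Rightarrow> real" where
  "eta_SLM P_LO P_RF P_IT K S r \<rho> N w =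
     (let A = A_coeff K S r \<rho> (P_cir_SLM P_LO P_RF P_IT K N) w;
          B = B_coeff K S r \<rho> w;
          K' = real (card S)
      in K' / (A * ln 2) * lambert_W (A * ln 2 / K' * exp (B * ln 2 / K' - 1)))"

end

(* Since w * exp w = x gives w = ln x - ln w, the Lambert function satisfies W x ~ ln x. The
   circuit power makes A ~ P_IT / 2 * N^2, while every omega_k grows like N, so the argument X of W
   satisfies ln X ~ ln (N^2) + ln N = 3 ln N. *)
theory Submission
  imports Defs "HOL-Real_Asymp.Real_Asymp"
begin

text \<open>The definite description is well defined for positive \<open>x\<close>:
  \<open>w * exp w\<close> has the sign of \<open>w\<close>, so every real solution is positive, and
  there the map is strictly increasing. A solution exists by the intermediate value theorem on
  \<open>[0, x]\<close>, because \<open>x \<le> x * exp x\<close>.\<close>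

lemma lambert_W_props:
  assumes "x > 0"
  shows "lambert_W x \<ge> - 1 \<and> lambert_W x * exp (lambert_W x) = x"
  unfolding lambert_W_def
proof (rule theI')
  have "\<exists>w\<ge>0. w \<le> x \<and> w * exp w = x"
  proof (rule IVT')
    have "x * 1 \<le> x * exp x"
      using assms by (intro mult_left_mono) auto
    thus "x \<le> x * exp x" by simp
  qed (use assms in \<open>auto intro!: continuous_intros\<close>)
  then obtain w where w: "w \<ge> 0" "w * exp w = x" by blast
  have mono: "a * exp a < b * exp b" if "0 < a" "a < b" for a b :: real
    using that by (intro mult_strict_mono) auto
  have "v = w" if v: "v * exp v = x" for v
  proof -
    have "v > 0" "w > 0"
      using v w(2) assms by (metis exp_gt_zero zero_less_mult_pos2)+
    thus ?thesis
      using mono[of v w] mono[of w v] v w(2) by (cases v w rule: linorder_cases) auto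
  qed
  thus "\<exists>!w. w \<ge> - 1 \<and> w * exp w = x"
    using w by (intro ex1I[of _ w]) (linarith | blast)+
qed

text \<open>The hypothesis \<open>x \<ge> exp 1\<close> forces \<open>w \<ge> 1\<close>, so
  \<open>ln w\<close> is nonnegative and \<open>w = ln x - ln w\<close> yields the upper bound.
  Inserting that bound into \<open>ln w\<close> yields the lower one.\<close>

lemma lambert_W_bounds:
  assumes "x \<ge> exp 1"
  shows "lambert_W x \<le> ln x" "ln x - ln (ln x) \<le> lambert_W x"
proof -
  define w where "w = lambert_W x"
  have "x > 0" using assms exp_gt_zero less_le_trans by blast
  hence w: "w * exp w = x"
    unfolding w_def using lambert_W_props by blast
  have "w > 0" using w \<open>x > 0\<close> by (metis exp_gt_zero zero_less_mult_pos2)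
  have "w \<ge> 1"
  proof (rule ccontr)
    assume "\<not> w \<ge> 1"
    hence "w * exp w < 1 * exp 1" using \<open>w > 0\<close> by (intro mult_strict_mono) auto
    thus False using w assms by simp
  qed
  have eq: "ln x = ln w + w"
    using w \<open>w > 0\<close> by (metis exp_gt_zero ln_exp ln_mult_pos)
  hence "w \<le> ln x" using \<open>w \<ge> 1\<close> by simp
  moreover from this have "ln w \<le> ln (ln x)" using \<open>w > 0\<close> by simp
  ultimately show "lambert_W x \<le> ln x" "ln x - ln (ln x) \<le> lambert_W x"
    unfolding w_def[symmetric] using eq by linarith+
qed

lemma lambert_W_asymp: "((\<lambda>x. lambert_W x / ln x) \<longlongrightarrow> 1) at_top"
proof (rule tendsto_sandwich)
  have large: "eventually (\<lambda>x::real. x \<ge> exp 1) at_top" by (rule eventually_ge_at_top)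
  have lnpos: "ln x > 0" if "x \<ge> exp 1" for x :: real
    using that by (smt (verit) exp_gt_one ln_gt_zero)
  show "eventually (\<lambda>x. (ln x - ln (ln x)) / ln x \<le> lambert_W x / ln x) at_top"
    using large by eventually_elim (meson divide_right_mono lambert_W_bounds(2) less_imp_le lnpos)
  show "eventually (\<lambda>x. lambert_W x / ln x \<le> 1) at_top"
    using large by eventually_elim (use lambert_W_bounds lnpos in \<open>simp add: field_simps\<close>)
  show "((\<lambda>x::real. (ln x - ln (ln x)) / ln x) \<longlongrightarrow> 1) at_top" by real_asymp
qed simp

text \<open>Write \<open>ln (f N) = p * ln N + ln (f N / N ^ p)\<close>. The last term tends to the
  finite number \<open>ln c\<close>, so it vanishes after division by \<open>ln N\<close>. Only the
  exponent survives, whatever the value of \<open>c\<close>.\<close>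

lemma ln_over_ln_of_power_growth:
  fixes f :: "nat \<Rightarrow> real"
  assumes lim: "(\<lambda>N. f N / real N ^ p) \<longlonglongrightarrow> c" and "c > 0"
  shows "(\<lambda>N. ln (f N) / ln (real N)) \<longlonglongrightarrow> real p"
proof -
  have "(\<lambda>N. ln (f N / real N ^ p) / ln (real N)) \<longlonglongrightarrow> 0"
    by (rule real_tendsto_divide_at_top[OF tendsto_ln[OF lim]])
       (use \<open>c > 0\<close> in simp, real_asymp)
  hence "(\<lambda>N. ln (f N / real N ^ p) / ln (real N) + real p) \<longlonglongrightarrow> 0 + real p"
    by (intro tendsto_intros)
  moreover have "eventually (\<lambda>N. ln (f N / real N ^ p) / ln (real N) + real p
      = ln (f N) / ln (real N)) sequentially"
    \<comment> \<open>The positive limit makes \<open>f N\<close> positive eventually, so that the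
      logarithm splits; \<open>N > 1\<close> makes \<open>ln N\<close> nonzero, so that it
      cancels.\<close>
    using order_tendstoD(1)[OF lim \<open>c > 0\<close>] eventually_gt_at_top[of 1]
  proof eventually_elim
    case (elim N)
    hence "f N > 0" "ln (real N) > 0" by (auto simp: zero_less_divide_iff)
    moreover from this elim have "ln (f N / real N ^ p) = ln (f N) - real p * ln (real N)"
      by (simp add: ln_div ln_realpow)
    ultimately show ?case by (simp add: field_simps)
  qed
  ultimately have "(\<lambda>N. ln (f N) / ln (real N)) \<longlonglongrightarrow> 0 + real p"
    by (rule Lim_transform_eventually)
  thus ?thesis by simp
qed

text \<open>The tuning elements supply the only quadratic term, with leading coefficient
  \<open>P_IT / 2\<close>. The remaining circuit power is constant, and the user sums decay because
  each \<open>w N k\<close> grows linearly.\<close>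

lemma A_coeff_growth:
  assumes w: "\<And>k. k \<in> {1..K} \<Longrightarrow> (\<lambda>N. w N k / real N) \<longlonglongrightarrow> c k"
    and c: "\<And>k. k \<in> {1..K} \<Longrightarrow> c k > 0" and S: "S \<subseteq> {1..K}"
  shows "(\<lambda>N. A_coeff K S r \<rho> (P_cir_SLM P_LO P_RF P_IT K N) (w N) / real N ^ 2)
           \<longlonglongrightarrow> P_IT / 2"
proof -
  have inv: "(\<lambda>N. a / w N k / real N ^ 2) \<longlonglongrightarrow> 0" if "k \<in> {1..K}" for a k
  proof -
    \<comment> \<open>The growth of \<open>w N k\<close> is known only through its quotient by
      \<open>N\<close>, hence the regrouping with a factor \<open>1 / N ^ 3\<close>.\<close>
    have "(\<lambda>N. a / (w N k / real N) * (1 / real N ^ 3)) \<longlonglongrightarrow> a / c k * 0"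
      by (intro tendsto_intros w that) (use c[OF that] in simp, real_asymp)
    moreover have "eventually (\<lambda>N. a / (w N k / real N) * (1 / real N ^ 3)
        = a / w N k / real N ^ 2) sequentially"
      using eventually_gt_at_top[of 0]
      by eventually_elim (simp add: power2_eq_square power3_eq_cube)
    ultimately have "(\<lambda>N. a / w N k / real N ^ 2) \<longlonglongrightarrow> a / c k * 0"
      by (rule Lim_transform_eventually)
    thus ?thesis by simp
  qed
  have P: "(\<lambda>N. P_cir_SLM P_LO P_RF P_IT K N / real N ^ 2) \<longlonglongrightarrow> P_IT / 2"
    unfolding P_cir_SLM_def by real_asymp
  have "(\<lambda>N. P_cir_SLM P_LO P_RF P_IT K N / real N ^ 2
      + 1 / \<rho> * (\<Sum>k\<in>{1..K} - S. (2 powr r - 1) / w N k / real N ^ 2)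
      - 1 / \<rho> * (\<Sum>k\<in>S. 1 / w N k / real N ^ 2))
      \<longlonglongrightarrow> P_IT / 2 + 1 / \<rho> * (\<Sum>k\<in>{1..K} - S. 0) - 1 / \<rho> * (\<Sum>k\<in>S. 0)"
    by (intro tendsto_intros P inv) (use S in auto)
  moreover have "A_coeff K S r \<rho> P (w N) / real N ^ 2 = P / real N ^ 2
      + 1 / \<rho> * (\<Sum>k\<in>{1..K} - S. (2 powr r - 1) / w N k / real N ^ 2)
      - 1 / \<rho> * (\<Sum>k\<in>S. 1 / w N k / real N ^ 2)" for P N
    unfolding A_coeff_def sum_divide_distrib[symmetric]
    by (simp only: add_divide_distrib diff_divide_distrib times_divide_eq_right)
  ultimately show ?thesis by simp
qed

text \<open>The factor \<open>ln 2\<close> turns binary logarithms into natural ones. Each user in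
  \<open>S\<close> then contributes \<open>ln (w N k) / ln N\<close>, which tends to 1 by linear
  growth.\<close>

lemma B_coeff_growth:
  assumes w: "\<And>k. k \<in> S \<Longrightarrow> (\<lambda>N. w N k / real N) \<longlonglongrightarrow> c k"
    and c: "\<And>k. k \<in> S \<Longrightarrow> c k > 0"
  shows "(\<lambda>N. B_coeff K S r \<rho> (w N) * ln 2 / ln (real N)) \<longlonglongrightarrow> real (card S)"
proof -
  \<comment> \<open>\<open>C\<close> collects the part of \<open>B * ln 2\<close> that is
    independent of \<open>N\<close>.\<close>
  define C where "C = ((real K - real (card S)) * r + real (card S) * log 2 (\<rho> / ln 2)) * ln 2"
  have lnw: "(\<lambda>N. ln (w N k) / ln (real N)) \<longlonglongrightarrow> 1" if "k \<in> S" for k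
    using ln_over_ln_of_power_growth[of "\<lambda>N. w N k" 1 "c k"] w[OF that] c[OF that] by simp
  have "(\<lambda>N. C / ln (real N) + (\<Sum>k\<in>S. ln (w N k) / ln (real N)))
      \<longlonglongrightarrow> 0 + (\<Sum>k\<in>S. 1)"
    by (intro tendsto_add tendsto_sum lnw) real_asymp
  moreover have "B_coeff K S r \<rho> (w N) * ln 2 / ln (real N)
      = C / ln (real N) + (\<Sum>k\<in>S. ln (w N k) / ln (real N))" for N
  proof -
    have "(\<Sum>k\<in>S. log 2 (w N k)) * ln 2 = (\<Sum>k\<in>S. ln (w N k))"
      by (simp add: log_def flip: sum_divide_distrib)
    hence "B_coeff K S r \<rho> (w N) * ln 2 = C + (\<Sum>k\<in>S. ln (w N k))"
      unfolding B_coeff_def C_def by (simp add: algebra_simps)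
    thus ?thesis by (simp add: add_divide_distrib flip: sum_divide_distrib)
  qed
  ultimately show ?thesis by simp
qed

text \<open>This is the deterministic core, applied later to one channel realization at a time. The
  constants \<open>c k\<close> affect only bounded terms of the logarithms and so leave the limit
  unchanged.\<close>

lemma eta_SLM_asymp:
  fixes w :: "nat \<Rightarrow> nat \<Rightarrow> real"
  assumes w: "\<And>k. k \<in> {1..K} \<Longrightarrow> (\<lambda>N. w N k / real N) \<longlonglongrightarrow> c k"
    and c: "\<And>k. k \<in> {1..K} \<Longrightarrow> c k > 0"
    and S: "S \<subseteq> {1..K}" "S \<noteq> {}" and "P_IT > 0"
  shows "(\<lambda>N. (real N)\<^sup>2 / ln (real N) * eta_SLM P_LO P_RF P_IT K S r \<rho> N (w N))
           \<longlonglongrightarrow> 6 * real (card S) / (P_IT * ln 2)"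
proof -
  define K' where "K' = real (card S)"
  define A where "A = (\<lambda>N. A_coeff K S r \<rho> (P_cir_SLM P_LO P_RF P_IT K N) (w N))"
  define B where "B = (\<lambda>N. B_coeff K S r \<rho> (w N))"
  define X where "X = (\<lambda>N. A N * ln 2 / K' * exp (B N * ln 2 / K' - 1))"
  have "finite S" using S(1) finite_subset by blast
  hence "K' > 0" unfolding K'_def using S(2) by (simp add: card_gt_0_iff)
  have A: "(\<lambda>N. A N / real N ^ 2) \<longlonglongrightarrow> P_IT / 2"
    unfolding A_def using w c S(1) by (rule A_coeff_growth)
  have B: "(\<lambda>N. B N * ln 2 / ln (real N)) \<longlonglongrightarrow> K'"
    unfolding B_def K'_def using w c S(1) by (intro B_coeff_growth[of S w c]) auto
  have Apos: "eventually (\<lambda>N. A N > 0) sequentially"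
    using order_tendstoD(1)[OF A, of 0] \<open>P_IT > 0\<close>
    by (auto elim!: eventually_mono simp: zero_less_divide_iff)
  have Xpos: "eventually (\<lambda>N. X N > 0) sequentially"
    using Apos by eventually_elim (use \<open>K' > 0\<close> in \<open>simp add: X_def\<close>)
  have ln_top: "filterlim (\<lambda>N. ln (real N)) at_top sequentially" by real_asymp
  \<comment> \<open>Of the limit 3, the prefactor \<open>A\<close> of order \<open>N ^ 2\<close>
    gives 2, and the exponent \<open>B * ln 2 / K'\<close>, asymptotic to \<open>ln N\<close>, gives
    1.\<close>
  have lnX: "(\<lambda>N. ln (X N) / ln (real N)) \<longlonglongrightarrow> 3"
  proof (rule Lim_transform_eventually)
    have "(\<lambda>N. ln (A N) / ln (real N)) \<longlonglongrightarrow> real 2"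
      using A \<open>P_IT > 0\<close> by (intro ln_over_ln_of_power_growth[of A 2 "P_IT / 2"]) auto
    moreover have "(\<lambda>N. (ln (ln 2 / K') - 1) / ln (real N)) \<longlonglongrightarrow> 0"
      by (rule real_tendsto_divide_at_top[OF tendsto_const ln_top])
    moreover have "(\<lambda>N. B N * ln 2 / ln (real N) / K') \<longlonglongrightarrow> K' / K'"
      using \<open>K' > 0\<close> by (intro tendsto_intros B) auto
    ultimately have "(\<lambda>N. ln (A N) / ln (real N) + (ln (ln 2 / K') - 1) / ln (real N)
        + B N * ln 2 / ln (real N) / K') \<longlonglongrightarrow> real 2 + 0 + K' / K'"
      by (intro tendsto_add)
    thus "(\<lambda>N. ln (A N) / ln (real N) + (ln (ln 2 / K') - 1) / ln (real N)
        + B N * ln 2 / ln (real N) / K') \<longlonglongrightarrow> 3" using \<open>K' > 0\<close> by simp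
    show "eventually (\<lambda>N. ln (A N) / ln (real N) + (ln (ln 2 / K') - 1) / ln (real N)
        + B N * ln 2 / ln (real N) / K' = ln (X N) / ln (real N)) sequentially"
      using Apos
    proof eventually_elim
      case (elim N)
      have "X N = A N * (ln 2 / K') * exp (B N * ln 2 / K' - 1)" by (simp add: X_def)
      also have "ln \<dots> = ln (A N) + ln (ln 2 / K') + (B N * ln 2 / K' - 1)"
        using elim \<open>K' > 0\<close> by (subst ln_mult_pos, simp, simp, subst ln_mult_pos) auto
      finally show ?case by (simp add: add_divide_distrib diff_divide_distrib mult.commute)
    qed
  qed
  \<comment> \<open>The divergence of \<open>X\<close> is recovered from \<open>lnX\<close>: the
    product with \<open>ln N\<close> diverges, and exponentiating returns \<open>X N\<close> once
    \<open>X N > 0\<close> and \<open>N > 1\<close>.\<close>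
  have "filterlim (\<lambda>N. ln (X N) / ln (real N) * ln (real N)) at_top sequentially"
    by (rule filterlim_tendsto_pos_mult_at_top[OF lnX _ ln_top]) simp
  hence "filterlim (\<lambda>N. exp (ln (X N) / ln (real N) * ln (real N))) at_top sequentially"
    by (rule filterlim_compose[OF exp_at_top])
  moreover have "eventually (\<lambda>N. exp (ln (X N) / ln (real N) * ln (real N)) = X N) sequentially"
    using Xpos eventually_gt_at_top[of 1] by eventually_elim simp
  ultimately have X_top: "filterlim X at_top sequentially"
    by (simp cong: filterlim_cong)
  have W: "(\<lambda>N. lambert_W (X N) / ln (X N)) \<longlonglongrightarrow> 1"
    by (rule filterlim_compose[OF lambert_W_asymp X_top])
  \<comment> \<open>The scaled efficiency factors through \<open>ln (X N)\<close> into three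
    quotients with known limits; the product is \<open>2 * K' / (P_IT * ln 2)\<close> times
    3.\<close>
  have "(\<lambda>N. K' / ln 2 / (A N / real N ^ 2) * (lambert_W (X N) / ln (X N))
      * (ln (X N) / ln (real N))) \<longlonglongrightarrow> K' / ln 2 / (P_IT / 2) * 1 * 3"
    using \<open>P_IT > 0\<close> by (intro tendsto_intros A W lnX) auto
  moreover have "eventually (\<lambda>N. K' / ln 2 / (A N / real N ^ 2) * (lambert_W (X N) / ln (X N))
      * (ln (X N) / ln (real N))
      = (real N)\<^sup>2 / ln (real N) * eta_SLM P_LO P_RF P_IT K S r \<rho> N (w N)) sequentially"
    using filterlim_at_top_dense[THEN iffD1, OF X_top, rule_format, of 1]
  proof eventually_elim
    case (elim N)
    have "eta_SLM P_LO P_RF P_IT K S r \<rho> N (w N) = K' / (A N * ln 2) * lambert_W (X N)"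
      by (simp add: eta_SLM_def Let_def A_def B_def X_def K'_def)
    \<comment> \<open>Only \<open>ln (X N)\<close> has to cancel. The other factors merely change
      places, which holds even for zero denominators.\<close>
    moreover have "ln (X N) \<noteq> 0" using elim by simp
    ultimately show ?case by (simp add: field_simps)
  qed
  ultimately have "(\<lambda>N. (real N)\<^sup>2 / ln (real N) * eta_SLM P_LO P_RF P_IT K S r \<rho> N (w N))
      \<longlonglongrightarrow> K' / ln 2 / (P_IT / 2) * 1 * 3"
    by (rule Lim_transform_eventually)
  thus ?thesis by (simp add: K'_def field_simps)
qed

theorem mainTheorem2:
  fixes M :: "'a measure"
    and K :: nat and S :: "nat set"
    and r \<rho> P_IT P_LO P_RF :: real
    and \<sigma> chi :: "nat \<Rightarrow> real"
    and h :: "nat \<Rightarrow> nat \<Rightarrow> 'a \<Rightarrow> nat \<Rightarrow> complex"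
  assumes "prob_space M"
    and "K \<ge> 1"
    and "S \<subseteq> {1..K}" and "S \<noteq> {}"
    and "r \<ge> 0" and "\<rho> > 0" and "P_IT > 0" and "P_LO > 0" and "P_RF > 0"
    and "\<And>k. k \<in> {1..K} \<Longrightarrow> (\<sigma> k)\<^sup>2 > 0"
    and "\<And>k. k \<in> {1..K} \<Longrightarrow> chi k > 0"
    and "\<And>N k. N \<ge> 1 \<Longrightarrow> k \<in> {1..K} \<Longrightarrow> h N k \<in> M \<rightarrow>\<^sub>M PiM {..<N} (\<lambda>_. borel)"
    and "\<And>k. k \<in> {1..K} \<Longrightarrow>
           AE x in M. (\<lambda>N. 1 / real N * (vec_norm N (h N k x))\<^sup>2) \<longlonglongrightarrow> chi k"
  shows "AE x in M.
           (\<lambda>N. (real N)\<^sup>2 / ln (real N) *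
                 eta_SLM P_LO P_RF P_IT K S r \<rho> N (omega N \<sigma> (\<lambda>k. h N k x)))
           \<longlonglongrightarrow> 6 * real (card S) / (P_IT * ln 2)"
proof -
  \<comment> \<open>Each user has its own exceptional null set. As there are finitely many users,
    one almost sure event serves them all.\<close>
  have "AE x in M. \<forall>k\<in>{1..K}.
      (\<lambda>N. 1 / real N * (vec_norm N (h N k x))\<^sup>2) \<longlonglongrightarrow> chi k"
    by (rule AE_finite_allI) (use assms(13) in auto)
  thus ?thesis
  proof eventually_elim
    case (elim x)
    show ?case
    \<comment> \<open>Dividing the channel limit \<open>chi k\<close> by the noise variance gives
      the linear growth rate of \<open>omega\<close>.\<close>
    proof (rule eta_SLM_asymp[where c = "\<lambda>k. chi k / (\<sigma> k)\<^sup>2"])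
      fix k assume k: "k \<in> {1..K}"
      have "(\<lambda>N. 1 / real N * (vec_norm N (h N k x))\<^sup>2 / (\<sigma> k)\<^sup>2)
          \<longlonglongrightarrow> chi k / (\<sigma> k)\<^sup>2"
        using elim k assms(10)[OF k] by (intro tendsto_intros) auto
      thus "(\<lambda>N. omega N \<sigma> (\<lambda>k. h N k x) k / real N) \<longlonglongrightarrow> chi k / (\<sigma> k)\<^sup>2"
        by (simp add: omega_def mult.commute)
      show "chi k / (\<sigma> k)\<^sup>2 > 0" using assms(10,11)[OF k] by simp
    qed (use assms in auto)
  qed
qed

end
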